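(* Let $\mathbb K=\mathbb R$ or $\mathbb C$, and let $V$ be a pure odd vector space over $\mathbb K$ with $\dim V=m$, equipped with an even non-degenerate skew-symmetric (in the super sense) bilinear form $(\,,)$; since $V$ is pure odd, this means $(a,b)=(b,a)$ for all $a,b\in V$. Then the classes of isomorphic (real or complex) invariant $(m-3)$-ary algebra structures on $V$ are in one-to-one correspondence with the coadjoint orbits of the Lie group $\mathrm{SO}(V)$.
   Context: An invariant $n$-ary algebra structure on the pure odd space $V$ is an $n$-linear map $V^n\to V$, $(a_1,\ldots,a_n)\mapsto\{a_1,\ldots,a_n\}$, which is commutative in the super sense (so, $V$ being pure odd, it is alternating in the ordinary sense) and satisfies $(a_0,\{a_1,\ldots,a_n\})=-(a_1,\{a_0,a_2,\ldots,a_n\})$ for all $a_i\in V$. $\mathrm{SO}(V)$ is the Lie group of linear operators on $V$ that preserve the form $(\,,)$ and have determinant $+1$. Its coadjoint orbits are the orbits of its coadjoint action on the dual of its Lie algebra $\mathfrak{so}(V)$. Two $n$-ary algebra structures $\{\ldots\}$ and $\{\ldots\}'$ on $V$ are called isomorphic if there is $\varphi\in\mathrm{SO}(V)$ with $\varphi(\{v_1,\ldots,v_n\})=\{\varphi(v_1),\ldots,\varphi(v_n)\}'$ for all $v_i\in V$. *)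

theory Defs
  imports Complex_Main "Jordan_Normal_Form.Determinant"
begin

locale fin_dim_space = vector_space scale
  for scale :: "'k::field \<Rightarrow> 'v::ab_group_add \<Rightarrow> 'v" +
  assumes finite_dim: "\<exists>S. finite S \<and> span S = UNIV"


subsection \<open>Determinant of an operator\<close>

context fin_dim_space
begin

definition ordered_basis :: "'v list \<Rightarrow> bool" where
  "ordered_basis bs \<longleftrightarrow> distinct bs \<and> independent (set bs) \<and> span (set bs) = UNIV"

definition op_matrix :: "'v list \<Rightarrow> 'v list \<Rightarrow> ('v \<Rightarrow> 'v) \<Rightarrow> 'k mat" where
  "op_matrix bs cs f =
     mat (length bs) (length cs) (\<lambda>(i, j). representation (set bs) (f (cs ! j)) (bs ! i))"

definition op_det :: "('v \<Rightarrow> 'v) \<Rightarrow> 'k" where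
  "op_det f = (let bs = SOME bs. ordered_basis bs in det (op_matrix bs bs f))"

lemma sum_ordered_basis:
  assumes "ordered_basis bs"
  shows "(\<Sum>k<length bs. scale (representation (set bs) x (bs ! k)) (bs ! k)) = x"
proof -
  have d: "distinct bs" and i: "independent (set bs)" and s: "span (set bs) = UNIV"
    using assms by (auto simp: ordered_basis_def)
  have "(\<Sum>k<length bs. scale (representation (set bs) x (bs ! k)) (bs ! k))
      = (\<Sum>b\<in>set bs. scale (representation (set bs) x b) b)"
    by (rule sum.reindex_bij_betw[OF bij_betw_nth[OF d refl refl]])
  also have "\<dots> = x"
    using i s by (intro sum_representation_eq) auto
  finally show ?thesis .
qed

lemma op_matrix_comp:
  assumes bs: "ordered_basis bs" and cs: "ordered_basis cs"
    and f: "Vector_Spaces.linear scale scale f"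
  shows "op_matrix bs ds (f \<circ> g) = op_matrix bs cs f * op_matrix cs ds g"
proof (rule eq_matI)
  fix i j
  assume "i < dim_row (op_matrix bs cs f * op_matrix cs ds g)"
    and "j < dim_col (op_matrix bs cs f * op_matrix cs ds g)"
  then have ij: "i < length bs" "j < length ds"
    by (auto simp: op_matrix_def)
  interpret f: Vector_Spaces.linear scale scale f by (rule f)
  have i: "independent (set bs)" and s: "span (set bs) = UNIV"
    using bs by (auto simp: ordered_basis_def)
  let ?r = "representation (set bs)" and ?c = "\<lambda>k. representation (set cs) (g (ds ! j)) (cs ! k)"
  have "f (g (ds ! j)) = f (\<Sum>k<length cs. scale (?c k) (cs ! k))"
    by (simp add: sum_ordered_basis[OF cs])
  then have "?r (f (g (ds ! j))) (bs ! i)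
      = ?r (\<Sum>k<length cs. scale (?c k) (f (cs ! k))) (bs ! i)"
    by (simp add: f.sum f.scale)
  also have "\<dots> = (\<Sum>k<length cs. ?c k * ?r (f (cs ! k)) (bs ! i))"
    using i s by (simp add: representation_sum representation_scale)
  finally show "op_matrix bs ds (f \<circ> g) $$ (i, j)
      = (op_matrix bs cs f * op_matrix cs ds g) $$ (i, j)"
    using ij by (simp add: op_matrix_def scalar_prod_def lessThan_atLeast0 mult.commute)
qed (auto simp: op_matrix_def)

lemma op_matrix_id:
  assumes "ordered_basis bs"
  shows "op_matrix bs bs id = 1\<^sub>m (length bs)"
  using assms
  by (intro eq_matI)
    (auto simp: op_matrix_def ordered_basis_def representation_basis nth_eq_iff_index_eq)

lemma det_op_matrix_unique:
  assumes bs: "ordered_basis bs" and cs: "ordered_basis cs"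
    and f: "Vector_Spaces.linear scale scale f"
  shows "det (op_matrix bs bs f) = det (op_matrix cs cs f)"
proof -
  have len: "length cs = length bs"
    using bs cs unfolding ordered_basis_def
    by (metis dim_eq_card_independent dim_span distinct_card)
  let ?P = "op_matrix bs cs id" and ?Q = "op_matrix cs bs id" and ?n = "length bs"
  have car: "?P \<in> carrier_mat ?n ?n" "?Q \<in> carrier_mat ?n ?n" "op_matrix cs cs f \<in> carrier_mat ?n ?n"
    by (simp_all add: op_matrix_def len)
  have lid: "Vector_Spaces.linear scale scale id" by (rule linear_id)
  have "op_matrix bs bs f = op_matrix bs cs f * ?Q"
    using op_matrix_comp[OF bs cs f, of bs id] by simp
  also have "op_matrix bs cs f = ?P * op_matrix cs cs f"
    using op_matrix_comp[OF bs cs lid, of cs f] by simp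
  finally have "det (op_matrix bs bs f) = det ?P * det (op_matrix cs cs f) * det ?Q"
    using det_mult[OF mult_carrier_mat[OF car(1,3)] car(2)] det_mult[OF car(1,3)] by (simp only:)
  moreover have "det ?P * det ?Q = 1"
  proof -
    have "?P * ?Q = 1\<^sub>m ?n"
      using op_matrix_comp[OF bs cs lid, of bs id] op_matrix_id[OF bs] by simp
    then show ?thesis
      using det_mult[OF car(1,2)] by simp
  qed
  ultimately show ?thesis
    by (simp add: mult.commute mult.left_commute)
qed

lemma op_det_eq:
  assumes "ordered_basis bs" and "Vector_Spaces.linear scale scale f"
  shows "op_det f = det (op_matrix bs bs f)"
proof -
  have "ordered_basis (SOME bs. ordered_basis bs)"
    using assms(1) by (rule someI)
  then show ?thesis
    unfolding op_det_def Let_def using assms by (intro det_op_matrix_unique)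
qed

end


text \<open>
  A purely odd space carries no more data than its underlying vector space. On such a space every
  bilinear form is even, and skew-symmetry in the super sense is ordinary symmetry.
\<close>

locale odd_form_space = fin_dim_space scale
  for scale :: "'k::field \<Rightarrow> 'v::ab_group_add \<Rightarrow> 'v" +
  fixes form :: "'v \<Rightarrow> 'v \<Rightarrow> 'k"
  assumes form_linear_left: "Vector_Spaces.linear scale (*) (\<lambda>x. form x y)"
    and form_linear_right: "Vector_Spaces.linear scale (*) (form x)"
    and form_sym: "form x y = form y x"
    and form_nondegenerate: "(\<forall>y. form x y = 0) \<Longrightarrow> x = 0"
begin

subsection \<open>Invariant algebra structures\<close>

text \<open>
  Elements of \<open>V\<^sup>n\<close> are lists of length \<open>n\<close>, and an \<open>n\<close>-ary operation takes the value \<open>0\<close> on lists of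
  any other length, so that equal operations on \<open>V\<^sup>n\<close> are equal functions. For \<open>n = 0\<close> an operation
  is a vector, and the conditions below are vacuous.
\<close>

definition multilinear :: "nat \<Rightarrow> ('v list \<Rightarrow> 'v) \<Rightarrow> bool" where
  "multilinear n f \<longleftrightarrow>
     (\<forall>vs i. length vs = n \<longrightarrow> i < n \<longrightarrow> Vector_Spaces.linear scale scale (\<lambda>v. f (vs[i := v])))"

text \<open>On odd arguments the sign rule turns commutativity into a change of sign.\<close>

definition super_commutative :: "nat \<Rightarrow> ('v list \<Rightarrow> 'v) \<Rightarrow> bool" where
  "super_commutative n f \<longleftrightarrow>
     (\<forall>vs i j. length vs = n \<longrightarrow> i < j \<longrightarrow> j < n \<longrightarrow> f (vs[i := vs ! j, j := vs ! i]) = - f vs)"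

definition invariant :: "nat \<Rightarrow> ('v list \<Rightarrow> 'v) \<Rightarrow> bool" where
  "invariant n f \<longleftrightarrow>
     (\<forall>a b vs. Suc (length vs) = n \<longrightarrow> form a (f (b # vs)) = - form b (f (a # vs)))"

definition invariant_structures :: "nat \<Rightarrow> ('v list \<Rightarrow> 'v) set" where
  "invariant_structures n =
     {f. multilinear n f \<and> super_commutative n f \<and> invariant n f \<and> (\<forall>vs. length vs \<noteq> n \<longrightarrow> f vs = 0)}"


subsection \<open>The group \<open>SO(V)\<close> and isomorphism classes\<close>

definition SO :: "('v \<Rightarrow> 'v) set" where
  "SO = {\<phi>. Vector_Spaces.linear scale scale \<phi> \<and> (\<forall>x y. form (\<phi> x) (\<phi> y) = form x y) \<and> op_det \<phi> = 1}"

definition isomorphic :: "nat \<Rightarrow> ('v list \<Rightarrow> 'v) \<Rightarrow> ('v list \<Rightarrow> 'v) \<Rightarrow> bool" where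
  "isomorphic n f g \<longleftrightarrow> (\<exists>\<phi>\<in>SO. \<forall>vs. length vs = n \<longrightarrow> \<phi> (f vs) = g (map \<phi> vs))"

definition isomorphism_classes :: "nat \<Rightarrow> ('v list \<Rightarrow> 'v) set set" where
  "isomorphism_classes n = invariant_structures n //
     {(f, g). f \<in> invariant_structures n \<and> g \<in> invariant_structures n \<and> isomorphic n f g}"


subsection \<open>Coadjoint orbits\<close>

text \<open>
  The Lie algebra of \<open>SO(V)\<close>: differentiating \<open>form (\<phi> x) (\<phi> y) = form x y\<close> at the identity gives
  the skew-adjoint operators, and the determinant imposes no further condition.
\<close>

definition so :: "('v \<Rightarrow> 'v) set" where
  "so = {X. Vector_Spaces.linear scale scale X \<and> (\<forall>x y. form (X x) y + form x (X y) = 0)}"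

text \<open>Functionals on \<open>so\<close> are extended by \<open>0\<close> to all functions, again to make equality extensional.\<close>

definition so_dual :: "(('v \<Rightarrow> 'v) \<Rightarrow> 'k) set" where
  "so_dual =
     {l. (\<forall>X\<in>so. \<forall>Y\<in>so. l (\<lambda>v. X v + Y v) = l X + l Y) \<and>
         (\<forall>c. \<forall>X\<in>so. l (\<lambda>v. scale c (X v)) = c * l X) \<and>
         (\<forall>X. X \<notin> so \<longrightarrow> l X = 0)}"

text \<open>Conjugation by \<open>\<phi> \<in> SO\<close> preserves \<open>so\<close> and its complement, hence also \<open>so_dual\<close>.\<close>

definition coadjoint :: "('v \<Rightarrow> 'v) \<Rightarrow> (('v \<Rightarrow> 'v) \<Rightarrow> 'k) \<Rightarrow> (('v \<Rightarrow> 'v) \<Rightarrow> 'k)" where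
  "coadjoint \<phi> l = (\<lambda>X. l (inv_into UNIV \<phi> \<circ> X \<circ> \<phi>))"

definition coadjoint_orbits :: "(('v \<Rightarrow> 'v) \<Rightarrow> 'k) set set" where
  "coadjoint_orbits = (\<lambda>l. (\<lambda>\<phi>. coadjoint \<phi> l) ` SO) ` so_dual"


subsection \<open>Linear isomorphisms from structures to functionals\<close>

definition linear_iso_so_dual :: "nat \<Rightarrow> (('v list \<Rightarrow> 'v) \<Rightarrow> (('v \<Rightarrow> 'v) \<Rightarrow> 'k)) \<Rightarrow> bool" where
  "linear_iso_so_dual n \<Phi> \<longleftrightarrow>
     bij_betw \<Phi> (invariant_structures n) so_dual \<and>
     (\<forall>f\<in>invariant_structures n. \<forall>g\<in>invariant_structures n.
        \<Phi> (\<lambda>vs. f vs + g vs) = (\<lambda>X. \<Phi> f X + \<Phi> g X)) \<and>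
     (\<forall>c. \<forall>f\<in>invariant_structures n. \<Phi> (\<lambda>vs. scale c (f vs)) = (\<lambda>X. c * \<Phi> f X))"

end

end

(*
  Fix a basis and let vol be the determinant in its coordinates, an alternating form in m arguments.
  An invariant (m-3)-ary structure f is the same thing as the alternating (m-2)-form
  (a_0, f a_1 ... a_(m-3)). For arguments a of length m-2, let X_a in so(V) be the operator with
  (X_a x, y) = vol(x, y, a). A functional l on so(V) yields the alternating form a |-> l(X_a), hence
  a structure. An alternating form is determined by its values on subsets of the basis, and the X_a
  with a running through the complements of the two-element subsets of the basis are a basis of
  so(V); so this assignment is a linear bijection. It is equivariant because elements of SO(V)
  preserve vol, and so it matches coadjoint orbits with isomorphism classes.
*)
theory Submission
  imports Defs
begin

section \<open>Reordering lists by transpositions\<close>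

text \<open>Every permutation is a product of transpositions, and \<open>P\<close> survives each of
  them. This carries the vanishing of an alternating form from one ordering of its arguments to all
  orderings.\<close>

lemma swap_invariant_mset:
  fixes xs ys :: "'a list"
  assumes swap: "\<And>zs i j. length zs = length xs \<Longrightarrow> i < j \<Longrightarrow> j < length xs \<Longrightarrow> P zs
      \<Longrightarrow> P (zs[i := zs ! j, j := zs ! i])"
    and "P xs" "mset ys = mset xs"
  shows "P ys"
proof -
  obtain p where p: "p permutes {..<length xs}" "permute_list p xs = ys"
    using assms(3) by (rule mset_eq_permutation)
  have "P zs \<longrightarrow> length zs = length xs \<longrightarrow> P (permute_list p zs)" for zs
    using p(1) finite_lessThan
  proof (induction arbitrary: zs rule: permutes_induct)
    case id
    then show ?case by simp
  next
    case (swap a b p)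
    show ?case
    proof (intro impI)
      assume zs: "P zs" "length zs = length xs"
      let ?zs = "permute_list (Transposition.transpose a b) zs"
      \<comment> \<open>The hypothesis on \<open>P\<close> covers swaps with the smaller index
        first, so the transposition is written in both orders.\<close>
      have "?zs = zs[a := zs ! b, b := zs ! a]" "?zs = zs[b := zs ! a, a := zs ! b]"
        using swap.hyps zs
        by (auto intro!: nth_equalityI simp: permute_list_def nth_list_update transpose_def)
      then have "P ?zs"
        using assms(1)[of zs a b] assms(1)[of zs b a] zs swap.hyps
        by (metis lessThan_iff linorder_neqE_nat)
      then show "P (permute_list (Transposition.transpose a b \<circ> p) zs)"
        using swap zs by (simp add: permute_list_compose)
    qed
  qed
  then show ?thesis using assms(2) p by blast
qed

context fin_dim_space
begin

subsection \<open>Alternating forms\<close>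

lemma linear_form_iff:
  "Vector_Spaces.linear scale (*) g \<longleftrightarrow>
    (\<forall>x y. g (x + y) = g x + g y) \<and> (\<forall>c x. g (scale c x) = c * g x)"
proof -
  have "vector_space ((*) :: 'k \<Rightarrow> 'k \<Rightarrow> 'k)"
    by unfold_locales (auto simp: algebra_simps)
  then show ?thesis
    by (simp add: Vector_Spaces.linear_iff vector_space_axioms)
qed

lemma linear_op_iff:
  "Vector_Spaces.linear scale scale g \<longleftrightarrow>
    (\<forall>x y. g (x + y) = g x + g y) \<and> (\<forall>c x. g (scale c x) = scale c (g x))"
  by (simp add: Vector_Spaces.linear_iff vector_space_axioms)

lemma linear_form_eq_0_on_basis:
  assumes "Vector_Spaces.linear scale (*) g" "span B = UNIV" "\<And>b. b \<in> B \<Longrightarrow> g b = 0"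
  shows "g x = 0"
proof -
  interpret g: Vector_Spaces.linear scale "(*)" g by (rule assms(1))
  show ?thesis using g.eq_0_on_span[of B x] assms(2,3) by simp
qed

lemma linear_op_inj_imp_surj:
  assumes "Vector_Spaces.linear scale scale g" "inj g"
  shows "surj g"
proof -
  obtain S where "finite S" "span S = UNIV" using finite_dim by blast
  obtain B where "B \<subseteq> S" "independent B" "span B = UNIV"
    using \<open>span S = UNIV\<close> maximal_independent_subset[of S]
    by (metis span_subspace subspace_UNIV span_mono span_span subset_antisym top_greatest)
  then interpret finite_dimensional_vector_space scale B
    using \<open>finite S\<close> by unfold_locales (auto intro: finite_subset)
  show ?thesis by (rule linear_inj_imp_surj[OF assms])
qed

text \<open>Alternation is stated through sign changes under swaps; vanishing on repeated arguments
  follows once 2 is nonzero. Lists of other lengths are unconstrained.\<close>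

definition alternating_form :: "nat \<Rightarrow> ('v list \<Rightarrow> 'k) \<Rightarrow> bool" where
  "alternating_form n \<omega> \<longleftrightarrow>
    (\<forall>vs i. length vs = n \<longrightarrow> i < n \<longrightarrow> Vector_Spaces.linear scale (*) (\<lambda>v. \<omega> (vs[i := v]))) \<and>
    (\<forall>vs i j. length vs = n \<longrightarrow> i < j \<longrightarrow> j < n \<longrightarrow> \<omega> (vs[i := vs ! j, j := vs ! i]) = - \<omega> vs)"

lemma alternating_form_linear:
  "alternating_form n \<omega> \<Longrightarrow> length vs = n \<Longrightarrow> i < n \<Longrightarrow>
    Vector_Spaces.linear scale (*) (\<lambda>v. \<omega> (vs[i := v]))"
  by (simp add: alternating_form_def)

lemma alternating_form_swap:
  "alternating_form n \<omega> \<Longrightarrow> length vs = n \<Longrightarrow> i < j \<Longrightarrow> j < n \<Longrightarrow>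
    \<omega> (vs[i := vs ! j, j := vs ! i]) = - \<omega> vs"
  by (simp add: alternating_form_def)

text \<open>Swapping two equal entries fixes the list but negates the value, so twice the value is
  0.\<close>

lemma alternating_form_not_distinct:
  assumes "alternating_form n \<omega>" "length vs = n" "\<not> distinct vs" "(2 :: 'k) \<noteq> 0"
  shows "\<omega> vs = 0"
proof -
  obtain i j where ij: "i < j" "j < n" "vs ! i = vs ! j"
    using assms(2,3) by (metis distinct_conv_nth linorder_neqE_nat)
  then have "\<omega> vs = - \<omega> vs"
    using alternating_form_swap[OF assms(1,2) ij(1,2)] ij(3) by (metis list_update_id)
  then have "2 * \<omega> vs = 0" by (metis add.right_inverse mult_2)
  then show ?thesis using assms(4) by simp
qed

text \<open>An arbitrary but fixed ordering, which lets the values of an alternating form be indexed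
  by sets; another ordering changes such a value at most by a sign.\<close>

definition enum :: "'v set \<Rightarrow> 'v list" where
  "enum S = (SOME xs. set xs = S \<and> distinct xs)"

lemma enum:
  assumes "finite S"
  shows "set (enum S) = S" "distinct (enum S)" "length (enum S) = card S"
proof -
  have "\<exists>xs. set xs = S \<and> distinct xs" using assms finite_distinct_list by blast
  then have *: "set (enum S) = S \<and> distinct (enum S)" unfolding enum_def by (rule someI_ex)
  then show "set (enum S) = S" "distinct (enum S)" by auto
  then show "length (enum S) = card S" by (metis distinct_card)
qed

text \<open>For lists over \<open>B\<close>, a repeated entry gives 0 and a distinct list is a
  reordering of some \<open>enum S\<close>. Multilinearity then frees the entries one position at a
  time.\<close>

lemma alternating_form_eq_0:
  assumes \<omega>: "alternating_form n \<omega>" and two: "(2 :: 'k) \<noteq> 0" and B: "finite B" "span B = UNIV"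
    and zero: "\<And>S. S \<subseteq> B \<Longrightarrow> card S = n \<Longrightarrow> \<omega> (enum S) = 0"
    and "length vs = n"
  shows "\<omega> vs = 0"
proof -
  have basis: "\<omega> vs = 0" if vs: "set vs \<subseteq> B" "length vs = n" for vs
  proof (cases "distinct vs")
    case True
    have S: "finite (set vs)" "card (set vs) = n" using True vs distinct_card by auto
    show ?thesis
    proof (rule swap_invariant_mset[where P = "\<lambda>vs. \<omega> vs = 0" and xs = "enum (set vs)"])
      show "mset vs = mset (enum (set vs))"
        using S True enum[OF S(1)] by (metis set_eq_iff_mset_eq_distinct)
      show "\<omega> (enum (set vs)) = 0" using zero vs S by simp
      show "\<omega> (zs[i := zs ! j, j := zs ! i]) = 0"
        if "length zs = length (enum (set vs))" "i < j" "j < length (enum (set vs))" "\<omega> zs = 0"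
        for zs i j
        using alternating_form_swap[OF \<omega>, of zs i j] that enum[OF S(1)] S by simp
    qed
  qed (use alternating_form_not_distinct[OF \<omega>] vs two in auto)
  \<comment> \<open>The first \<open>k\<close> entries are already arbitrary, while those from
    position \<open>k\<close> on still lie in \<open>B\<close>.\<close>
  have "k \<le> n \<Longrightarrow> \<forall>vs. length vs = n \<longrightarrow> (\<forall>i. k \<le> i \<longrightarrow> i < n \<longrightarrow> vs ! i \<in> B) \<longrightarrow> \<omega> vs = 0" for k
  proof (induction k)
    case 0
    then show ?case using basis by (auto simp: in_set_conv_nth subset_iff)
  next
    case (Suc k)
    show ?case
    proof (intro allI impI)
      fix vs assume vs: "length vs = n" "\<forall>i. Suc k \<le> i \<longrightarrow> i < n \<longrightarrow> vs ! i \<in> B"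
      have "\<omega> (vs[k := b]) = 0" if "b \<in> B" for b
        using Suc that vs by (auto simp: nth_list_update)
      then have "\<omega> (vs[k := v]) = 0" for v
        using linear_form_eq_0_on_basis[OF alternating_form_linear[OF \<omega> vs(1), of k] B(2)] Suc.prems
        by simp
      from this[of "vs ! k"] show "\<omega> vs = 0" by simp
    qed
  qed
  from this[of n] show ?thesis using assms(6) by auto
qed

lemma alternating_form_diff:
  assumes "alternating_form n \<omega>" "alternating_form n \<eta>"
  shows "alternating_form n (\<lambda>vs. \<omega> vs - \<eta> vs)"
  using assms unfolding alternating_form_def linear_form_iff by (auto simp: algebra_simps)

lemma alternating_form_eqI:
  assumes "alternating_form n \<omega>" "alternating_form n \<eta>" "(2 :: 'k) \<noteq> 0" "finite B" "span B = UNIV"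
    and "\<And>S. S \<subseteq> B \<Longrightarrow> card S = n \<Longrightarrow> \<omega> (enum S) = \<eta> (enum S)"
    and "length vs = n"
  shows "\<omega> vs = \<eta> vs"
  using alternating_form_eq_0[OF alternating_form_diff[OF assms(1,2)] assms(3-5)] assms(6,7) by simp

section \<open>The volume form of a basis\<close>

lemma representation_linear:
  assumes "ordered_basis bs"
  shows "representation (set bs) (x + y) b = representation (set bs) x b + representation (set bs) y b"
    "representation (set bs) (scale c x) b = c * representation (set bs) x b"
  using assms unfolding ordered_basis_def by (auto simp: representation_add representation_scale)

text \<open>With \<open>id\<close> as the operator, the columns of the matrix are the coordinates of
  the vectors in \<open>vs\<close> with respect to \<open>bs\<close>.\<close>

definition volume :: "'v list \<Rightarrow> 'v list \<Rightarrow> 'k" where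
  "volume bs vs = det (op_matrix bs vs id)"

text \<open>Linearity in an argument is Laplace expansion along its column; exchanging arguments
  exchanges columns.\<close>

lemma volume_alternating:
  assumes bs: "ordered_basis bs"
  shows "alternating_form (length bs) (volume bs)"
  unfolding alternating_form_def
proof (intro conjI allI impI)
  fix vs :: "'v list" and j assume vs: "length vs = length bs" "j < length bs"
  let ?n = "length bs"
  let ?A = "\<lambda>v. op_matrix bs (vs[j := v]) id"
  \<comment> \<open>Cofactors along column \<open>j\<close> ignore that column, so they do not
    depend on \<open>v\<close>; the vector 0 serves as a placeholder.\<close>
  have cof: "cofactor (?A v) i j = cofactor (?A 0) i j" for i v
  proof -
    have "mat_delete (?A v) i j = mat_delete (?A 0) i j"
      by (rule eq_matI) (auto simp: mat_delete_def op_matrix_def vs)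
    then show ?thesis by (simp add: cofactor_def)
  qed
  have "volume bs (vs[j := v]) = (\<Sum>i<?n. representation (set bs) v (bs ! i) * cofactor (?A 0) i j)" for v
  proof -
    have "det (?A v) = (\<Sum>i<?n. ?A v $$ (i,j) * cofactor (?A v) i j)"
      using vs by (intro laplace_expansion_column) (auto simp: op_matrix_def)
    also have "\<dots> = (\<Sum>i<?n. representation (set bs) v (bs ! i) * cofactor (?A 0) i j)"
      unfolding cof[of v] using vs by (intro sum.cong) (auto simp: op_matrix_def)
    finally show ?thesis by (simp add: volume_def)
  qed
  then show "Vector_Spaces.linear scale (*) (\<lambda>v. volume bs (vs[j := v]))"
    unfolding linear_form_iff
    by (simp add: representation_linear[OF bs] sum.distrib sum_distrib_left algebra_simps)
next
  fix vs :: "'v list" and i j assume vs: "length vs = length bs" "i < j" "j < length bs"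
  let ?A = "op_matrix bs vs id"
  have "op_matrix bs (vs[i := vs ! j, j := vs ! i]) id = swapcols i j ?A"
    using vs by (intro eq_matI) (auto simp: op_matrix_def)
  moreover have "det (swapcols i j ?A) = - det ?A"
    using vs by (intro det_swapcols[of i "length bs"]) (auto simp: op_matrix_def)
  ultimately show "volume bs (vs[i := vs ! j, j := vs ! i]) = - volume bs vs"
    by (simp add: volume_def)
qed

text \<open>The coordinates of the images are the matrix of \<open>f\<close> times the coordinates
  of \<open>vs\<close>, and determinants multiply. Hence operators of determinant 1 preserve the
  volume.\<close>

lemma volume_map:
  assumes bs: "ordered_basis bs" and f: "Vector_Spaces.linear scale scale f"
    and vs: "length vs = length bs"
  shows "volume bs (map f vs) = op_det f * volume bs vs"
proof -
  have "op_matrix bs (map f vs) id = op_matrix bs vs f"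
    by (rule eq_matI) (auto simp: op_matrix_def)
  also have "\<dots> = op_matrix bs bs f * op_matrix bs vs id"
    using op_matrix_comp[OF bs bs f, of vs id] by simp
  finally show ?thesis
    using det_mult[of "op_matrix bs bs f" "length bs" "op_matrix bs vs id"] vs
    by (simp add: volume_def op_det_eq[OF bs f] op_matrix_def)
qed

text \<open>A reordering of a basis is again an ordered basis, so the matrix in question is an
  invertible change of coordinates.\<close>

lemma volume_basis_neq_0:
  assumes bs: "ordered_basis bs" and vs: "distinct vs" "set vs = set bs"
  shows "volume bs vs \<noteq> 0"
proof -
  have cs: "ordered_basis vs" using assms by (simp add: ordered_basis_def)
  have len: "length vs = length bs" using assms by (metis distinct_card ordered_basis_def)
  have "op_matrix vs bs id * op_matrix bs vs id = 1\<^sub>m (length bs)"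
    using op_matrix_comp[OF cs bs linear_id, of vs id] op_matrix_id[OF cs] len by simp
  then have "det (op_matrix vs bs id) * det (op_matrix bs vs id) = 1"
    using det_mult[of "op_matrix vs bs id" "length bs" "op_matrix bs vs id"] len
    by (simp add: op_matrix_def)
  then show ?thesis by (auto simp: volume_def)
qed


section \<open>Leading arguments of alternating forms\<close>

lemma alternating_form_Cons:
  assumes "alternating_form (Suc n) \<omega>"
  shows "alternating_form n (\<lambda>vs. \<omega> (x # vs))"
  unfolding alternating_form_def
proof (intro conjI allI impI)
  fix vs :: "'v list" and i assume "length vs = n" "i < n"
  then show "Vector_Spaces.linear scale (*) (\<lambda>v. \<omega> (x # vs[i := v]))"
    using alternating_form_linear[OF assms, of "x # vs" "Suc i"] by simp
next
  fix vs :: "'v list" and i j assume "length vs = n" "i < j" "j < n"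
  then show "\<omega> (x # vs[i := vs ! j, j := vs ! i]) = - \<omega> (x # vs)"
    using alternating_form_swap[OF assms, of "x # vs" "Suc i" "Suc j"] by simp
qed

lemma alternating_form_linear_hd:
  "alternating_form (Suc n) \<omega> \<Longrightarrow> length vs = n \<Longrightarrow> Vector_Spaces.linear scale (*) (\<lambda>v. \<omega> (v # vs))"
  using alternating_form_linear[of "Suc n" \<omega> "0 # vs" 0] by simp

lemma alternating_form_swap_hd:
  "alternating_form (Suc (Suc n)) \<omega> \<Longrightarrow> length vs = n \<Longrightarrow> \<omega> (y # x # vs) = - \<omega> (x # y # vs)"
  using alternating_form_swap[of "Suc (Suc n)" \<omega> "x # y # vs" 0 1] by simp

end

context odd_form_space
begin

subsection \<open>The form, \<open>so\<close> and \<open>SO\<close>\<close>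

lemma form_simps [simp]:
  "form (x + y) z = form x z + form y z" "form (scale c x) z = c * form x z"
  "form z (x + y) = form z x + form z y" "form z (scale c x) = c * form z x"
  using form_linear_left form_linear_right unfolding linear_form_iff by auto

lemma form_zero [simp]: "form 0 z = 0" "form z 0 = 0"
  using form_simps(2)[of 0 0 z] form_simps(4)[of z 0 0] by simp_all

lemma form_minus [simp]: "form (- x) z = - form x z" "form z (- x) = - form z x"
  using form_simps(1,3)[of x "- x"] form_simps(3)[of z x "- x"]
  by (simp_all add: eq_neg_iff_add_eq_0 add.commute)

lemma form_diff: "form (x - z) y = form x y - form z y"
  using form_simps(1)[of "x - z" z y] by simp

lemma form_sum: "form (\<Sum>i\<in>A. f i) z = (\<Sum>i\<in>A. form (f i) z)"
  by (induction A rule: infinite_finite_induct) auto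

lemma form_eqI: "(\<And>y. form x y = form z y) \<Longrightarrow> x = z"
  using form_nondegenerate[of "x - z"] by (simp add: form_diff)

text \<open>The vector representing \<open>g\<close> through \<open>form\<close>; it is meaningful
  for linear \<open>g\<close>, where existence is proved next and uniqueness is
  nondegeneracy.\<close>

definition riesz :: "('v \<Rightarrow> 'k) \<Rightarrow> 'v" where
  "riesz g = (SOME v. \<forall>y. form v y = g y)"

text \<open>The map \<open>F\<close> sends \<open>v\<close> to the vector whose coordinates are the
  values of \<open>form v\<close> on a basis. It is injective by nondegeneracy, hence surjective, so
  every choice of values on the basis is attained.\<close>

lemma form_riesz:
  assumes g: "Vector_Spaces.linear scale (*) g"
  shows "form (riesz g) y = g y"
proof -
  obtain S where "finite S" "span S = UNIV" using finite_dim by blast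
  obtain B where B: "B \<subseteq> S" "independent B" "S \<subseteq> span B"
    using maximal_independent_subset[of S] by metis
  then have span: "span B = UNIV"
    using \<open>span S = UNIV\<close> by (metis span_mono span_span top.extremum_uniqueI)
  have fin: "finite B" using B \<open>finite S\<close> finite_subset by blast
  define F where "F = (\<lambda>v. \<Sum>b\<in>B. scale (form v b) b)"
  have F: "Vector_Spaces.linear scale scale F"
    unfolding linear_op_iff F_def by (simp add: scale_left_distrib sum.distrib scale_sum_right)
  have lin: "Vector_Spaces.linear scale (*) (\<lambda>y. form v y - h y)"
    if "Vector_Spaces.linear scale (*) h" for v h
    using that unfolding linear_form_iff by (auto simp: algebra_simps)
  have ext: "form v y = h y" if "Vector_Spaces.linear scale (*) h" "\<And>b. b \<in> B \<Longrightarrow> form v b = h b" for v h y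
    using linear_form_eq_0_on_basis[OF lin[OF that(1)] span] that(2) by simp
  have coeff: "form v b = c b" if "F v = (\<Sum>b\<in>B. scale (c b) b)" "b \<in> B" for v c b
  proof -
    have "(\<Sum>b\<in>B. scale (form v b - c b) b) = 0"
      using that(1) by (simp add: F_def scale_left_diff_distrib sum_subtractf)
    then show ?thesis using independentD[OF B(2) fin subset_refl] that(2) by fastforce
  qed
  have "inj F"
  proof (rule injI)
    fix v w assume "F v = F w"
    then have "form v b = form w b" if "b \<in> B" for b
      using coeff[of v "form w"] that by (simp add: F_def)
    then show "v = w" using ext[of "form w" v] form_linear_right form_eqI by metis
  qed
  then have "surj F" by (rule linear_op_inj_imp_surj[OF F])
  then obtain v where "F v = (\<Sum>b\<in>B. scale (g b) b)" by (metis surjD)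
  then have "\<forall>y. form v y = g y" using coeff ext[OF g] by blast
  then show ?thesis
    using someI_ex[of "\<lambda>v. \<forall>y. form v y = g y"] unfolding riesz_def by blast
qed

section \<open>The Lie algebra and its dual\<close>

lemma soD:
  assumes "Z \<in> so"
  shows "Z (x + y) = Z x + Z y" "Z (scale c x) = scale c (Z x)" "form (Z y) x = - form (Z x) y"
proof -
  have lin: "Vector_Spaces.linear scale scale Z" and skew: "form (Z y) x + form y (Z x) = 0"
    using assms by (auto simp: so_def)
  show "Z (x + y) = Z x + Z y" "Z (scale c x) = scale c (Z x)"
    using lin by (simp_all add: linear_op_iff)
  show "form (Z y) x = - form (Z x) y"
    using skew unfolding form_sym[of y "Z x"] by (simp add: eq_neg_iff_add_eq_0)
qed

text \<open>Nondegeneracy lifts linearity of the scalar functions to \<open>Z\<close> itself. This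
  suits operators that are known only through their pairings.\<close>

lemma soI:
  assumes "\<And>x y. form (Z y) x = - form (Z x) y" "\<And>x. Vector_Spaces.linear scale (*) (\<lambda>y. form (Z y) x)"
  shows "Z \<in> so"
proof -
  have "Z (x + y) = Z x + Z y" "Z (scale c x) = scale c (Z x)" for x y c
    using assms(2) unfolding linear_form_iff by (auto intro!: form_eqI)
  moreover have "form (Z x) y + form x (Z y) = 0" for x y
    using assms(1)[of x y] form_sym[of x "Z y"] by simp
  ultimately show ?thesis
    by (simp add: so_def linear_op_iff)
qed

text \<open>Skew-adjoint operators become alternating 2-forms, so two of them can be compared on
  pairs of basis vectors.\<close>

lemma so_form_alternating:
  assumes "Z \<in> so"
  shows "alternating_form 2 (\<lambda>vs. form (Z (vs ! 0)) (vs ! 1))"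
proof -
  have "form (Z (vs ! 1)) (vs ! 0) = - form (Z (vs ! 0)) (vs ! 1)" for vs
    by (rule soD(3)[OF assms])
  then show ?thesis
    unfolding alternating_form_def linear_form_iff
    by (auto simp: soD(1,2)[OF assms] less_2_cases_iff less_Suc_eq numeral_2_eq_2)
qed

lemma so_dualD:
  assumes "l \<in> so_dual"
  shows "Z \<in> so \<Longrightarrow> Y \<in> so \<Longrightarrow> l (\<lambda>v. Z v + Y v) = l Z + l Y"
    "Z \<in> so \<Longrightarrow> l (\<lambda>v. scale c (Z v)) = c * l Z" "Z \<notin> so \<Longrightarrow> l Z = 0"
  using assms unfolding so_dual_def by auto

lemma so_add:
  assumes "Z \<in> so" "Y \<in> so"
  shows "(\<lambda>v. Z v + Y v) \<in> so"
proof (rule soI)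
  show "form (Z y + Y y) x = - form (Z x + Y x) y" for x y
    using soD(3)[OF assms(1), of y x] soD(3)[OF assms(2), of y x] by simp
qed (simp add: soD(1,2)[OF assms(1)] soD(1,2)[OF assms(2)] linear_form_iff algebra_simps)

lemma so_scale:
  assumes "Z \<in> so"
  shows "(\<lambda>v. scale c (Z v)) \<in> so"
proof (rule soI)
  show "form (scale c (Z y)) x = - form (scale c (Z x)) y" for x y
    using soD(3)[OF assms, of y x] by simp
qed (simp add: soD(1,2)[OF assms] linear_form_iff algebra_simps)

lemma so_zero: "(\<lambda>v. 0) \<in> so"
  by (rule soI) (auto simp: linear_form_iff)

text \<open>Membership in \<open>so\<close> is carried through the induction because
  \<open>l\<close> is known to be additive only there.\<close>

lemma so_dual_sum:
  assumes l: "l \<in> so_dual" and "finite A" "\<And>S. S \<in> A \<Longrightarrow> Z S \<in> so"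
  shows "(\<lambda>v. \<Sum>S\<in>A. scale (c S) (Z S v)) \<in> so \<and>
    l (\<lambda>v. \<Sum>S\<in>A. scale (c S) (Z S v)) = (\<Sum>S\<in>A. c S * l (Z S))"
  using assms(2,3)
proof (induction A rule: finite_induct)
  case empty
  then show ?case using so_dualD(2)[OF l so_zero, of 0] so_zero by simp
next
  case (insert S A)
  then show ?case by (simp add: so_dualD[OF l] so_add so_scale)
qed

section \<open>Invariant structures as alternating forms\<close>

definition structure_form :: "('v list \<Rightarrow> 'v) \<Rightarrow> 'v list \<Rightarrow> 'k" where
  "structure_form f vs = form (hd vs) (f (tl vs))"

text \<open>Swaps inside the tail are commutativity, and swapping the head with the next entry is
  invariance. The remaining swaps are composed of these.\<close>

lemma structure_form_alternating:
  assumes f: "f \<in> invariant_structures n"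
  shows "alternating_form (Suc n) (structure_form f)"
  unfolding alternating_form_def
proof (intro conjI allI impI)
  fix vs :: "'v list" and i assume vs: "length vs = Suc n" "i < Suc n"
  obtain a as where a: "vs = a # as" using vs by (cases vs) auto
  show "Vector_Spaces.linear scale (*) (\<lambda>v. structure_form f (vs[i := v]))"
  proof (cases i)
    case 0
    then show ?thesis using form_linear_left by (simp add: a structure_form_def)
  next
    case (Suc k)
    then have "Vector_Spaces.linear scale scale (\<lambda>v. f (as[k := v]))"
      using f vs a unfolding invariant_structures_def multilinear_def by simp
    then show ?thesis by (simp add: a Suc structure_form_def linear_op_iff linear_form_iff)
  qed
next
  fix vs :: "'v list" and i j assume vs: "length vs = Suc n" "i < j" "j < Suc n"
  obtain a as where a: "vs = a # as" using vs by (cases vs) auto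
  obtain k where k: "j = Suc k" using vs by (cases j) auto
  have comm: "f (ws[i := ws ! j, j := ws ! i]) = - f ws" if "length ws = n" "i < j" "j < n" for ws i j
    using f that unfolding invariant_structures_def super_commutative_def by blast
  have inv: "form x (f (y # ws)) = - form y (f (x # ws))" if "Suc (length ws) = n" for x y ws
    using f that unfolding invariant_structures_def invariant_def by blast
  show "structure_form f (vs[i := vs ! j, j := vs ! i]) = - structure_form f vs"
  proof (cases i)
    case (Suc h)
    then show ?thesis using comm[of as h k] vs a k by (simp add: structure_form_def)
  next
    case 0
    have len: "length as = n" "k < n" using vs a k by auto
    then obtain b bs where b: "as = b # bs" by (cases as) auto
    show ?thesis
    proof (cases k)
      case 0
      then show ?thesis
        using inv[of bs b a] len a b k \<open>i = 0\<close> by (simp add: structure_form_def)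
    next
      case (Suc h)
      have h: "h < length bs" "Suc (length bs) = n" using len b Suc by auto
      let ?c = "bs ! h"
      \<comment> \<open>The head is exchanged with a later entry by commutativity, invariance and
        commutativity again: three sign changes, hence one sign.\<close>
      have "form ?c (f (b # bs[h := a])) = - form ?c (f (a # bs[h := b]))"
        using comm[of "a # bs[h := b]" 0 "Suc h"] h by simp
      also have "\<dots> = form a (f (?c # bs[h := b]))"
        using inv[of "bs[h := b]" ?c a] h by simp
      also have "\<dots> = - form a (f (b # bs))"
        using comm[of "b # bs" 0 "Suc h"] h by simp
      finally show ?thesis using \<open>i = 0\<close> Suc a b k by (simp add: structure_form_def)
    qed
  qed
qed

text \<open>Conversely, nondegeneracy transfers each identity from \<open>\<omega>\<close> to the
  operation it defines; invariance is the swap of the first two arguments.\<close>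

lemma invariant_structureI:
  assumes \<omega>: "alternating_form (Suc n) \<omega>"
    and f: "\<And>y vs. length vs = n \<Longrightarrow> form y (f vs) = \<omega> (y # vs)"
    and "\<And>vs. length vs \<noteq> n \<Longrightarrow> f vs = 0"
  shows "f \<in> invariant_structures n"
proof -
  have f': "form (f vs) y = \<omega> (y # vs)" if "length vs = n" for y vs
    using f[OF that] form_sym by metis
  note \<omega>' = alternating_form_Cons[OF \<omega>]
  have "multilinear n f"
    unfolding multilinear_def linear_op_iff
    using alternating_form_linear[OF \<omega>'] unfolding linear_form_iff
    by (auto intro!: form_eqI simp: f')
  moreover have "super_commutative n f"
    unfolding super_commutative_def using alternating_form_swap[OF \<omega>']
    by (auto intro!: form_eqI simp: f')
  moreover have "invariant n f"
    unfolding invariant_def using alternating_form_swap_hd \<omega> f by auto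
  ultimately show ?thesis using assms(3) by (simp add: invariant_structures_def)
qed

section \<open>The group and its coadjoint action\<close>

lemma SO_bij:
  assumes "\<phi> \<in> SO"
  shows "bij \<phi>"
proof -
  have lin: "Vector_Spaces.linear scale scale \<phi>" and pres: "\<And>x y. form (\<phi> x) (\<phi> y) = form x y"
    using assms by (auto simp: SO_def)
  have "inj \<phi>" by (rule injI) (metis form_eqI pres)
  then show ?thesis using linear_op_inj_imp_surj[OF lin] by (simp add: bij_def)
qed

lemma SO_simps:
  assumes "\<phi> \<in> SO"
  shows "form (\<phi> x) (\<phi> y) = form x y"
    "\<phi> (inv_into UNIV \<phi> x) = x" "inv_into UNIV \<phi> (\<phi> x) = x"
    "form (inv_into UNIV \<phi> x) y = form x (\<phi> y)"
    "\<phi> (x + y) = \<phi> x + \<phi> y" "\<phi> (scale c x) = scale c (\<phi> x)"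
proof -
  show pres: "form (\<phi> x) (\<phi> y) = form x y" for x y using assms by (auto simp: SO_def)
  show inv: "\<phi> (inv_into UNIV \<phi> x) = x" "inv_into UNIV \<phi> (\<phi> x) = x" for x
    using SO_bij[OF assms] by (simp_all add: bij_is_inj bij_is_surj surj_f_inv_f)
  show "form (inv_into UNIV \<phi> x) y = form x (\<phi> y)"
    using pres[of "inv_into UNIV \<phi> x" y] inv by simp
  show "\<phi> (x + y) = \<phi> x + \<phi> y" "\<phi> (scale c x) = scale c (\<phi> x)"
    using assms by (auto simp: SO_def linear_op_iff)
qed

lemma SO_inv_linear:
  assumes "\<phi> \<in> SO"
  shows "inv_into UNIV \<phi> (x + y) = inv_into UNIV \<phi> x + inv_into UNIV \<phi> y"
    "inv_into UNIV \<phi> (scale c x) = scale c (inv_into UNIV \<phi> x)"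
  by (rule form_eqI, simp add: SO_simps(4)[OF assms])+

text \<open>Moving both arguments back along \<open>\<phi>\<close> turns the pairing of
  \<open>Z\<close> into that of its conjugate, which gives the converse. The converse makes a
  coadjoint translate vanish outside \<open>so\<close>.\<close>

lemma so_conj_iff:
  assumes \<phi>: "\<phi> \<in> SO"
  shows "inv_into UNIV \<phi> \<circ> Z \<circ> \<phi> \<in> so \<longleftrightarrow> Z \<in> so"
proof
  assume Z: "Z \<in> so"
  show "inv_into UNIV \<phi> \<circ> Z \<circ> \<phi> \<in> so"
  proof (rule soI)
    show "form ((inv_into UNIV \<phi> \<circ> Z \<circ> \<phi>) y) x = - form ((inv_into UNIV \<phi> \<circ> Z \<circ> \<phi>) x) y" for x y
      using soD(3)[OF Z, of "\<phi> y" "\<phi> x"] by (simp add: SO_simps[OF \<phi>])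
  qed (simp add: SO_simps[OF \<phi>] soD(1,2)[OF Z] linear_form_iff)
next
  assume *: "inv_into UNIV \<phi> \<circ> Z \<circ> \<phi> \<in> so"
  have Z: "form (Z y) x
      = form ((inv_into UNIV \<phi> \<circ> Z \<circ> \<phi>) (inv_into UNIV \<phi> y)) (inv_into UNIV \<phi> x)" for x y
    by (simp add: SO_simps[OF \<phi>])
  show "Z \<in> so"
  proof (rule soI)
    show "form (Z y) x = - form (Z x) y" for x y
      unfolding Z by (rule soD(3)[OF *])
    show "Vector_Spaces.linear scale (*) (\<lambda>y. form (Z y) x)" for x
      unfolding Z linear_form_iff SO_inv_linear[OF \<phi>] soD(1,2)[OF *] by simp
  qed
qed

lemma coadjoint_so_dual:
  assumes \<phi>: "\<phi> \<in> SO" and l: "l \<in> so_dual"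
  shows "coadjoint \<phi> l \<in> so_dual"
proof -
  let ?c = "\<lambda>Z. inv_into UNIV \<phi> \<circ> Z \<circ> \<phi>"
  have "?c (\<lambda>v. Z v + Y v) = (\<lambda>v. ?c Z v + ?c Y v)"
    "?c (\<lambda>v. scale c (Z v)) = (\<lambda>v. scale c (?c Z v))"
    for Z Y c
    by (simp_all add: fun_eq_iff SO_inv_linear[OF \<phi>])
  then show ?thesis
    using so_dualD[OF l]
    by (simp add: so_dual_def coadjoint_def so_conj_iff[OF \<phi>] del: o_apply)
qed

end

text \<open>Writing the dimension as \<open>n + 3\<close> avoids truncated subtraction: structures
  have arity \<open>n\<close>, their forms take \<open>n + 1\<close> arguments and the volume takes
  \<open>n + 3\<close>.\<close>

locale based_odd_form_space = odd_form_space scale form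
  for scale :: "'k::field \<Rightarrow> 'v::ab_group_add \<Rightarrow> 'v" and form :: "'v \<Rightarrow> 'v \<Rightarrow> 'k" +
  fixes bs :: "'v list" and n :: nat
  assumes basis: "ordered_basis bs" and two_neq_0: "(2 :: 'k) \<noteq> 0"
    and length_basis: "length bs = Suc (Suc (Suc n))"
begin

subsection \<open>The correspondence given by a volume form\<close>

lemma volume_alt: "alternating_form (Suc (Suc (Suc n))) (volume bs)"
  using volume_alternating[OF basis] by (simp add: length_basis)

text \<open>Filling the last \<open>n + 1\<close> slots of the volume with \<open>vs\<close> leaves
  a 2-form; this is the operator representing it.\<close>

definition so_elem :: "'v list \<Rightarrow> 'v \<Rightarrow> 'v" where
  "so_elem vs x = riesz (\<lambda>y. volume bs (x # y # vs))"

lemma form_so_elem: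
  assumes "length vs = Suc n"
  shows "form (so_elem vs x) y = volume bs (x # y # vs)"
  unfolding so_elem_def
  using alternating_form_linear_hd[OF alternating_form_Cons[OF volume_alt] assms] by (rule form_riesz)

lemma so_elem_so:
  assumes vs: "length vs = Suc n"
  shows "so_elem vs \<in> so"
proof (rule soI)
  show "form (so_elem vs y) x = - form (so_elem vs x) y" for x y
    using alternating_form_swap_hd[OF volume_alt vs, of y x] by (simp add: form_so_elem vs)
  show "Vector_Spaces.linear scale (*) (\<lambda>y. form (so_elem vs y) x)" for x
    using alternating_form_linear_hd[OF volume_alt, of "x # vs"] by (simp add: form_so_elem vs)
qed

text \<open>By nondegeneracy the operator \<open>so_elem vs\<close> inherits multilinearity and sign
  changes in \<open>vs\<close> from the volume, and \<open>l\<close> is linear on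
  \<open>so\<close>.\<close>

lemma functional_alternating:
  assumes l: "l \<in> so_dual"
  shows "alternating_form (Suc n) (\<lambda>vs. l (so_elem vs))"
proof -
  have alt: "alternating_form (Suc n) (\<lambda>vs. volume bs (x # y # vs))" for x y
    by (intro alternating_form_Cons volume_alt)
  note lin = alternating_form_linear[OF alt, unfolded linear_form_iff]
  have "so_elem (vs[i := u + v]) = (\<lambda>x. so_elem (vs[i := u]) x + so_elem (vs[i := v]) x)"
    and "so_elem (vs[i := scale c u]) = (\<lambda>x. scale c (so_elem (vs[i := u]) x))"
    if "length vs = Suc n" "i < Suc n" for vs i u v c
    using lin[OF that] that by (auto intro!: ext form_eqI simp: form_so_elem)
  \<comment> \<open>The sign is written as scaling by -1 to match the homogeneity clause of
    \<open>so_dual\<close>.\<close>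
  moreover have "so_elem (vs[i := vs ! j, j := vs ! i]) = (\<lambda>x. scale (-1) (so_elem vs x))"
    if "length vs = Suc n" "i < j" "j < Suc n" for vs i j
    using alternating_form_swap[OF alt that] that by (auto intro!: ext form_eqI simp: form_so_elem)
  ultimately show ?thesis
    unfolding alternating_form_def linear_form_iff
    by (simp add: so_dualD(1,2)[OF l] so_elem_so del: scale_minus_left)
qed

section \<open>A basis of the Lie algebra indexed by pairs of basis vectors\<close>

definition pairs :: "'v set set" where
  "pairs = {S. S \<subseteq> set bs \<and> card S = 2}"

definition co_enum :: "'v set \<Rightarrow> 'v list" where
  "co_enum S = enum (set bs - S)"

lemma finite_pairs: "finite pairs"
  unfolding pairs_def by (rule finite_subset[of _ "Pow (set bs)"]) auto

lemma card_basis: "card (set bs) = Suc (Suc (Suc n))"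
  using basis length_basis distinct_card by (fastforce simp: ordered_basis_def)

lemma pairs_enum:
  assumes "S \<in> pairs"
  shows "set (enum S) = S" "distinct (enum S)" "length (enum S) = 2"
    "enum S = [enum S ! 0, enum S ! 1]"
proof -
  have S: "finite S" "card S = 2" using assms by (auto simp: pairs_def finite_subset)
  then show "set (enum S) = S" "distinct (enum S)" and len: "length (enum S) = 2"
    using enum[OF S(1)] by auto
  show "enum S = [enum S ! 0, enum S ! 1]"
    by (rule nth_equalityI) (auto simp: len less_2_cases_iff)
qed

lemma co_enum:
  assumes "S \<in> pairs"
  shows "set (co_enum S) = set bs - S" "distinct (co_enum S)" "length (co_enum S) = Suc n"
proof -
  have "card (set bs - S) = Suc n"
    using assms card_basis card_Diff_subset[of S "set bs"] finite_subset[of S "set bs"]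
    by (simp add: pairs_def)
  then show "set (co_enum S) = set bs - S" "distinct (co_enum S)" "length (co_enum S) = Suc n"
    unfolding co_enum_def using enum[of "set bs - S"] by auto
qed

text \<open>For \<open>S = T\<close> the list runs once through the basis. Otherwise
  \<open>S\<close>, having the size of \<open>T\<close>, meets the complement of \<open>T\<close>,
  and an entry repeats.\<close>

lemma volume_dual_pairs:
  assumes S: "S \<in> pairs" and T: "T \<in> pairs"
  shows "volume bs (enum S @ co_enum T) = 0 \<longleftrightarrow> S \<noteq> T"
proof (cases "S = T")
  case True
  have "set (enum S @ co_enum S) = set bs"
    using pairs_enum[OF S] co_enum[OF S] S by (auto simp: pairs_def)
  moreover have "distinct (enum S @ co_enum S)"
    using pairs_enum[OF S] co_enum[OF S] by auto
  ultimately show ?thesis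
    using volume_basis_neq_0[OF basis] True by blast
next
  case False
  have "\<not> S \<subseteq> T"
    using S T False card_subset_eq[of T S] finite_subset[of T "set bs"] by (auto simp: pairs_def)
  then have "\<not> distinct (enum S @ co_enum T)"
    using pairs_enum[OF S] co_enum[OF T] S by (auto simp: pairs_def)
  then show ?thesis
    using alternating_form_not_distinct[OF volume_alt _ _ two_neq_0] False
      pairs_enum(3)[OF S] co_enum(3)[OF T] by simp
qed

text \<open>The coordinate of \<open>Z\<close> at the operator \<open>so_elem (co_enum S)\<close>.
  The denominator is nonzero for \<open>S\<close> in \<open>pairs\<close> and normalises that
  operator's own coordinate to 1.\<close>

definition coeff :: "('v \<Rightarrow> 'v) \<Rightarrow> 'v set \<Rightarrow> 'k" where
  "coeff Z S = form (Z (enum S ! 0)) (enum S ! 1) / volume bs (enum S @ co_enum S)"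

lemma coeff_so_elem:
  assumes S: "S \<in> pairs" and T: "T \<in> pairs"
  shows "coeff (so_elem (co_enum T)) S = (if S = T then 1 else 0)"
proof -
  have "form (so_elem (co_enum T) (enum S ! 0)) (enum S ! 1) = volume bs (enum S @ co_enum T)"
    using form_so_elem[OF co_enum(3)[OF T]] pairs_enum(4)[OF S]
    by (metis append_Cons append_Nil)
  then show ?thesis using volume_dual_pairs[OF S T] by (cases "S = T") (simp_all add: coeff_def)
qed

text \<open>Both sides define alternating 2-forms, so it suffices to compare them on the pairs of
  basis vectors, where the dual coordinates single out one summand.\<close>

lemma so_decomposition:
  assumes Z: "Z \<in> so"
  shows "Z = (\<lambda>v. \<Sum>S\<in>pairs. scale (coeff Z S) (so_elem (co_enum S) v))"
proof -
  let ?Y = "\<lambda>v. \<Sum>S\<in>pairs. scale (coeff Z S) (so_elem (co_enum S) v)"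
  \<comment> \<open>The zero functional is a witness that lets \<open>so_dual_sum\<close> yield
    membership of the sum in \<open>so\<close>.\<close>
  have "(\<lambda>_. 0) \<in> so_dual" by (simp add: so_dual_def)
  then have Y: "?Y \<in> so"
    using so_dual_sum[of _ pairs "\<lambda>S. so_elem (co_enum S)"] finite_pairs
      so_elem_so co_enum(3) by blast
  have "form (Z (vs ! 0)) (vs ! 1) = form (?Y (vs ! 0)) (vs ! 1)" if "length vs = 2" for vs
  proof (rule alternating_form_eqI[where n = 2 and B = "set bs"
      and \<omega> = "\<lambda>vs. form (Z (vs ! 0)) (vs ! 1)" and \<eta> = "\<lambda>vs. form (?Y (vs ! 0)) (vs ! 1)"])
    show "span (set bs) = UNIV" using basis by (simp add: ordered_basis_def)
    fix T assume "T \<subseteq> set bs" "card T = 2"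
    then have T: "T \<in> pairs" by (simp add: pairs_def)
    have "coeff ?Y T = (\<Sum>S\<in>pairs. coeff Z S * coeff (so_elem (co_enum S)) T)"
      by (simp add: coeff_def form_sum sum_divide_distrib)
    also have "\<dots> = (\<Sum>S\<in>pairs. if S = T then coeff Z S else 0)"
      using T by (intro sum.cong) (auto simp: coeff_so_elem)
    also have "\<dots> = coeff Z T" using T finite_pairs by simp
    finally show "form (Z (enum T ! 0)) (enum T ! 1) = form (?Y (enum T ! 0)) (enum T ! 1)"
      using volume_dual_pairs[OF T T] by (simp add: coeff_def)
  qed (use so_form_alternating[OF Z] so_form_alternating[OF Y] two_neq_0 that in auto)
  from this[of "[_, _]"] have "form (Z x) y = form (?Y x) y" for x y by simp
  then show ?thesis by (intro ext form_eqI)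
qed

section \<open>Mutually inverse maps between functionals and structures\<close>

definition structure_of :: "(('v \<Rightarrow> 'v) \<Rightarrow> 'k) \<Rightarrow> 'v list \<Rightarrow> 'v" where
  "structure_of l vs = (if length vs = n then riesz (\<lambda>y. l (so_elem (y # vs))) else 0)"

text \<open>The linear extension of the prescription that \<open>so_elem (co_enum S)\<close> goes to
  the value of the structure form on \<open>co_enum S\<close>.\<close>

definition functional_of :: "('v list \<Rightarrow> 'v) \<Rightarrow> ('v \<Rightarrow> 'v) \<Rightarrow> 'k" where
  "functional_of f Z =
    (if Z \<in> so then \<Sum>S\<in>pairs. coeff Z S * structure_form f (co_enum S) else 0)"

lemma form_structure_of:
  assumes "l \<in> so_dual" "length vs = n"
  shows "form y (structure_of l vs) = l (so_elem (y # vs))"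
  using form_riesz[OF alternating_form_linear_hd[OF functional_alternating[OF assms(1)] assms(2)]]
    form_sym assms(2) by (simp add: structure_of_def)

lemma structure_form_structure_of:
  assumes "l \<in> so_dual" "length vs = Suc n"
  shows "structure_form (structure_of l) vs = l (so_elem vs)"
  using assms form_structure_of[of l "tl vs" "hd vs"] by (cases vs) (auto simp: structure_form_def)

lemma structure_of_invariant:
  assumes "l \<in> so_dual"
  shows "structure_of l \<in> invariant_structures n"
  by (rule invariant_structureI[OF functional_alternating[OF assms]])
    (auto simp: form_structure_of assms, simp add: structure_of_def)

lemma functional_of_so_dual: "functional_of f \<in> so_dual"
proof -
  have "coeff (\<lambda>v. Z v + Y v) S = coeff Z S + coeff Y S"
    "coeff (\<lambda>v. scale c (Z v)) S = c * coeff Z S"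
    for Z Y S c
    by (simp_all add: coeff_def add_divide_distrib)
  then show ?thesis
    unfolding so_dual_def functional_of_def
    by (simp add: so_add so_scale sum.distrib sum_distrib_left algebra_simps)
qed

lemma functional_of_structure_of:
  assumes l: "l \<in> so_dual"
  shows "functional_of (structure_of l) = l"
proof
  fix Z
  show "functional_of (structure_of l) Z = l Z"
  proof (cases "Z \<in> so")
    case True
    have "l Z = (\<Sum>S\<in>pairs. coeff Z S * l (so_elem (co_enum S)))"
      using so_dual_sum[OF l finite_pairs, of "\<lambda>S. so_elem (co_enum S)" "coeff Z"]
        so_decomposition[OF True] so_elem_so co_enum(3) by simp
    then show ?thesis
      using True by (simp add: functional_of_def structure_form_structure_of[OF l] co_enum(3))
  qed (simp add: functional_of_def so_dualD(3)[OF l])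
qed

text \<open>Two alternating forms in \<open>n + 1\<close> arguments are compared on subsets of the
  basis of that size, which are the complements of pairs.\<close>

lemma structure_of_functional_of:
  assumes f: "f \<in> invariant_structures n"
  shows "structure_of (functional_of f) = f"
proof
  fix vs
  let ?l = "functional_of f"
  have eq: "?l (so_elem us) = structure_form f us" if "length us = Suc n" for us
  proof (rule alternating_form_eqI[where n = "Suc n" and B = "set bs"
      and \<omega> = "\<lambda>us. ?l (so_elem us)" and \<eta> = "structure_form f"])
    show "span (set bs) = UNIV" using basis by (simp add: ordered_basis_def)
    fix R assume R: "R \<subseteq> set bs" "card R = Suc n"
    let ?T = "set bs - R"
    have T: "?T \<in> pairs"
      using R card_basis card_Diff_subset[of R "set bs"] finite_subset[of R "set bs"]
      by (auto simp: pairs_def)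
    \<comment> \<open>Since \<open>co_enum\<close> is defined through \<open>enum\<close>, the two
      orderings agree exactly and no sign appears.\<close>
    have co: "co_enum ?T = enum R"
      using R by (simp add: co_enum_def double_diff)
    have "?l (so_elem (co_enum ?T))
        = (\<Sum>S\<in>pairs. if S = ?T then structure_form f (co_enum S) else 0)"
      using T by (auto simp: functional_of_def so_elem_so co_enum(3) coeff_so_elem intro!: sum.cong)
    also have "\<dots> = structure_form f (co_enum ?T)"
      using T finite_pairs by simp
    finally show "?l (so_elem (enum R)) = structure_form f (enum R)" by (simp add: co)
  qed (use functional_alternating[OF functional_of_so_dual] structure_form_alternating[OF f]
      two_neq_0 that in auto)
  show "structure_of ?l vs = f vs"
  proof (cases "length vs = n")
    case True
    have "form y (structure_of ?l vs) = form y (f vs)" for y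
      using form_structure_of[OF functional_of_so_dual True] eq[of "y # vs"] True
      by (simp add: structure_form_def)
    then show ?thesis using form_sym by (metis form_eqI)
  next
    case False
    then show ?thesis using f by (simp add: structure_of_def invariant_structures_def)
  qed
qed

lemma functional_of_linear_iso: "linear_iso_so_dual n functional_of"
proof -
  have "bij_betw functional_of (invariant_structures n) so_dual"
    using functional_of_structure_of structure_of_functional_of structure_of_invariant
      functional_of_so_dual
    by (intro bij_betw_byWitness[where f' = structure_of]) auto
  then show ?thesis
    unfolding linear_iso_so_dual_def
    by (auto simp: fun_eq_iff functional_of_def structure_form_def sum.distrib sum_distrib_left
        algebra_simps)
qed

section \<open>Equivariance, isomorphism classes and orbits\<close>

text \<open>Elements of \<open>SO\<close> preserve both the volume and the form, so conjugation
  takes the operator of the transported arguments back to that of the original ones.\<close>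

lemma structure_of_coadjoint:
  assumes \<phi>: "\<phi> \<in> SO" and l: "l \<in> so_dual" and vs: "length vs = n"
  shows "structure_of (coadjoint \<phi> l) (map \<phi> vs) = \<phi> (structure_of l vs)"
proof -
  have elem: "inv_into UNIV \<phi> \<circ> so_elem (map \<phi> us) \<circ> \<phi> = so_elem us" if us: "length us = Suc n" for us
  proof (intro ext form_eqI)
    fix x y
    have "volume bs (map \<phi> (x # y # us)) = volume bs (x # y # us)"
      using volume_map[OF basis, of \<phi> "x # y # us"] \<phi> us by (simp add: SO_def length_basis)
    then show "form ((inv_into UNIV \<phi> \<circ> so_elem (map \<phi> us) \<circ> \<phi>) x) y = form (so_elem us x) y"
      using us by (simp add: SO_simps(4)[OF \<phi>] form_so_elem)
  qed
  \<comment> \<open>Testing against vectors \<open>\<phi> y\<close> suffices because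
    \<open>\<phi>\<close> is surjective.\<close>
  have "form (\<phi> y) (structure_of (coadjoint \<phi> l) (map \<phi> vs)) = form (\<phi> y) (\<phi> (structure_of l vs))" for y
    using form_structure_of[OF coadjoint_so_dual[OF \<phi> l], of "map \<phi> vs" "\<phi> y"] vs
      elem[of "y # vs"]
    by (simp add: coadjoint_def SO_simps(1)[OF \<phi>] form_structure_of[OF l])
  then show ?thesis using SO_simps(2)[OF \<phi>] form_sym by (metis form_eqI)
qed

text \<open>Every list of length \<open>n\<close> is the image of one under
  \<open>map \<phi>\<close>, so the isomorphism equation determines \<open>g\<close> there; on other
  lengths both operations are 0.\<close>

lemma isomorphic_structure_of_iff:
  assumes l: "l \<in> so_dual" and g: "g \<in> invariant_structures n"
  shows "isomorphic n (structure_of l) g \<longleftrightarrow> (\<exists>\<phi>\<in>SO. g = structure_of (coadjoint \<phi> l))"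
proof
  assume "isomorphic n (structure_of l) g"
  then obtain \<phi> where \<phi>: "\<phi> \<in> SO"
    and eq: "\<And>vs. length vs = n \<Longrightarrow> \<phi> (structure_of l vs) = g (map \<phi> vs)"
    by (auto simp: isomorphic_def)
  have "g vs = structure_of (coadjoint \<phi> l) vs" for vs
  proof (cases "length vs = n")
    case True
    have "map \<phi> (map (inv_into UNIV \<phi>) vs) = vs"
      by (simp add: map_idI SO_simps(2)[OF \<phi>])
    then show ?thesis
      using eq[of "map (inv_into UNIV \<phi>) vs"]
        structure_of_coadjoint[OF \<phi> l, of "map (inv_into UNIV \<phi>) vs"] True
      by (simp del: map_map)
  next
    case False
    then show ?thesis using g by (simp add: structure_of_def invariant_structures_def)
  qed
  then show "\<exists>\<phi>\<in>SO. g = structure_of (coadjoint \<phi> l)" using \<phi> by blast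
next
  assume "\<exists>\<phi>\<in>SO. g = structure_of (coadjoint \<phi> l)"
  then show "isomorphic n (structure_of l) g"
    using structure_of_coadjoint[OF _ l] unfolding isomorphic_def by metis
qed

lemma functional_of_class:
  assumes f: "f \<in> invariant_structures n"
  shows "functional_of ` {g \<in> invariant_structures n. isomorphic n f g}
    = (\<lambda>\<phi>. coadjoint \<phi> (functional_of f)) ` SO"
proof -
  let ?l = "functional_of f"
  have "{g \<in> invariant_structures n. isomorphic n f g} = (\<lambda>\<phi>. structure_of (coadjoint \<phi> ?l)) ` SO"
    using isomorphic_structure_of_iff[OF functional_of_so_dual[of f]] structure_of_functional_of[OF f]
      structure_of_invariant coadjoint_so_dual functional_of_so_dual by fastforce
  then show ?thesis
    by (simp add: image_image functional_of_structure_of coadjoint_so_dual functional_of_so_dual)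
qed

text \<open>An injective map of structures is injective on sets of structures, and it takes classes
  to orbits. Each orbit is reached because each functional comes from a structure.\<close>

lemma functional_of_bij_classes:
  "bij_betw (\<lambda>C. functional_of ` C) (isomorphism_classes n) coadjoint_orbits"
proof -
  have bij: "bij_betw functional_of (invariant_structures n) so_dual"
    using functional_of_linear_iso by (simp add: linear_iso_so_dual_def)
  have classes: "isomorphism_classes n
      = (\<lambda>f. {g \<in> invariant_structures n. isomorphic n f g}) ` invariant_structures n"
    unfolding isomorphism_classes_def quotient_def by auto
  have "inj_on (\<lambda>C. functional_of ` C) (isomorphism_classes n)"
    unfolding classes using bij
    by (intro inj_on_subset[OF inj_on_image_Pow[of functional_of "invariant_structures n"]])
      (auto simp: bij_betw_def)
  moreover have "(\<lambda>C. functional_of ` C) ` isomorphism_classes n = coadjoint_orbits"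
  proof -
    have "(\<lambda>C. functional_of ` C) ` isomorphism_classes n
        = (\<lambda>f. (\<lambda>\<phi>. coadjoint \<phi> (functional_of f)) ` SO) ` invariant_structures n"
      unfolding classes image_image by (rule image_cong) (auto simp: functional_of_class)
    also have "\<dots> = (\<lambda>l. (\<lambda>\<phi>. coadjoint \<phi> l) ` SO) ` functional_of ` invariant_structures n"
      by (simp add: image_image)
    finally show ?thesis using bij by (simp add: coadjoint_orbits_def bij_betw_def)
  qed
  ultimately show ?thesis by (simp add: bij_betw_def)
qed

end

lemma (in odd_form_space) structures_correspond_orbits:
  assumes "(2 :: 'k) \<noteq> 0" "m \<ge> 3" "dim UNIV = m"
  shows "\<exists>\<Phi>. linear_iso_so_dual (m - 3) \<Phi> \<and>
    bij_betw (\<lambda>C. \<Phi> ` C) (isomorphism_classes (m - 3)) coadjoint_orbits"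
proof -
  obtain B where B: "independent B" "span B = UNIV" "card B = m"
    using basis_exists[of UNIV] assms(3) by (metis UNIV_eq_I subset_UNIV top.extremum_uniqueI)
  \<comment> \<open>An infinite set has \<open>card\<close> 0, which \<open>m \<ge> 3\<close>
    excludes.\<close>
  then have "finite B" using assms(2) card.infinite by fastforce
  then obtain bs where "set bs = B" "distinct bs" using finite_distinct_list by blast
  then interpret based_odd_form_space scale form bs "m - 3"
    using B assms distinct_card[of bs] by unfold_locales (auto simp: ordered_basis_def)
  show ?thesis using functional_of_linear_iso functional_of_bij_classes by blast
qed

text \<open>In both fields 2 is nonzero, so the general correspondence applies to each. Asking that
  the bijection of classes be induced by a linear isomorphism makes it more than an equality of
  cardinalities.\<close>

theorem theorem2:
  fixes scaleR :: "real \<Rightarrow> 'v::ab_group_add \<Rightarrow> 'v" and formR :: "'v \<Rightarrow> 'v \<Rightarrow> real"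
    and scaleC :: "complex \<Rightarrow> 'w::ab_group_add \<Rightarrow> 'w" and formC :: "'w \<Rightarrow> 'w \<Rightarrow> complex"
    and m :: nat
  assumes "m \<ge> 3"
  shows
    "(odd_form_space scaleR formR \<and> vector_space.dim scaleR (UNIV :: 'v set) = m \<longrightarrow>
       (\<exists>\<Phi>. odd_form_space.linear_iso_so_dual scaleR formR (m - 3) \<Phi> \<and>
            bij_betw (\<lambda>C. \<Phi> ` C)
              (odd_form_space.isomorphism_classes scaleR formR (m - 3))
              (odd_form_space.coadjoint_orbits scaleR formR)))
     \<and>
     (odd_form_space scaleC formC \<and> vector_space.dim scaleC (UNIV :: 'w set) = m \<longrightarrow>
       (\<exists>\<Phi>. odd_form_space.linear_iso_so_dual scaleC formC (m - 3) \<Phi> \<and>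
            bij_betw (\<lambda>C. \<Phi> ` C)
              (odd_form_space.isomorphism_classes scaleC formC (m - 3))
              (odd_form_space.coadjoint_orbits scaleC formC)))"
  using odd_form_space.structures_correspond_orbits[of scaleR formR m]
    odd_form_space.structures_correspond_orbits[of scaleC formC m] assms
  by simp

end
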